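(* Let $k\ge6$ be an even integer and set $m_F=\mathcal{F}(k)$. Then $\pi_F(m_F)=k$, and $\pi_F(m)\ne k$ for every integer $m>m_F$. Moreover, $m_F=F_{k/2}$ if $k\equiv0\pmod4$ and $m_F=L_{k/2}$ if $k\equiv2\pmod4$.
   Context: $F_n$ are the Fibonacci numbers ($F_0=0,F_1=1$) and $L_n$ the Lucas numbers ($L_0=2,L_1=1$), both satisfying $x_n=x_{n-1}+x_{n-2}$. $\mathcal{F}(k)$ is the greatest common divisor of all sums $\sum_{i=0}^{k-1}F_{n+i}$, $n\ge1$. For $m\ge2$, $\pi_F(m)$ is the Pisano period: the smallest positive $r$ with $F_r\equiv0$ and $F_{r+1}\equiv1\pmod m$. *)

theory Defs
  imports "HOL-Number_Theory.Number_Theory"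
begin

fun lucas :: "nat \<Rightarrow> nat" where
  "lucas 0 = 2"
| "lucas (Suc 0) = 1"
| "lucas (Suc (Suc n)) = lucas (Suc n) + lucas n"

definition fib_sum_gcd :: "nat \<Rightarrow> nat" where
  "fib_sum_gcd k = Gcd {(\<Sum>i<k. fib (n + i)) | n. n \<ge> 1}"

(* The Fibonacci sequence modulo m is purely periodic, so the least element exists for all m > 0;
   the period is only meant for m >= 2. *)
definition pisano_fib :: "nat \<Rightarrow> nat" where
  "pisano_fib m = (LEAST r. r > 0 \<and> [fib r = 0] (mod m) \<and> [fib (r + 1) = 1] (mod m))"

end

theory Submission
  imports Defs
begin

text \<open>
  Since \<open>\<Sum>i<k. fib (n + i) = fib (n + 1 + k) - fib (n + 1)\<close>, a number divides all these sums
  iff \<open>k\<close> is a period of the Fibonacci sequence modulo that number; hence \<open>m\<^sub>F\<close> is the largest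
  modulus with period \<open>k\<close>, and \<open>m\<^sub>F = gcd (fib k) (fib (k + 1) - 1)\<close>. With \<open>k = 2 * h\<close>, Cassini's
  identity factors both entries, and the gcd is \<open>fib h\<close> or \<open>lucas h\<close> according to the parity
  of \<open>h\<close>. A smaller period \<open>r\<close> would make \<open>m\<^sub>F\<close> divide \<open>fib (gcd r k)\<close>, where \<open>gcd r k \<le> h\<close>.
  This is impossible by size if \<open>h\<close> is odd, and forces \<open>r = h\<close> if \<open>h\<close> is even; then
  \<open>fib h\<close> would divide \<open>fib (h - 1) - 1\<close>, which is positive and smaller.
\<close>

section \<open>Periods of the Fibonacci sequence modulo \<open>m\<close>\<close>

definition fib_period :: "nat \<Rightarrow> nat \<Rightarrow> bool" where
  "fib_period m r \<longleftrightarrow> [fib r = 0] (mod m) \<and> [fib (r + 1) = 1] (mod m)"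

lemma fib_period_shift:
  assumes "fib_period m r"
  shows "[fib (n + r) = fib n] (mod m)"
  using assms
  by (induction n rule: fib.induct) (auto simp: fib_period_def intro: cong_add)

text \<open>The recurrence also runs backwards, so agreement at two consecutive indices descends to
  the indices 0 and 1.\<close>

lemma fib_period_of_shift:
  assumes "[fib (i + r) = fib i] (mod m)" and "[fib (Suc i + r) = fib (Suc i)] (mod m)"
  shows "fib_period m r"
  using assms
proof (induction i)
  case 0
  then show ?case by (simp add: fib_period_def)
next
  case (Suc i)
  have "[fib (Suc i + r) + fib (i + r) = fib (Suc i) + fib i] (mod m)"
    using Suc.prems(2) by simp
  moreover have "[fib (Suc i) + fib i = fib (Suc i + r) + fib i] (mod m)"
    using cong_add[OF Suc.prems(1) cong_refl] by (simp add: cong_sym_eq)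
  ultimately have "[fib (i + r) = fib i] (mod m)"
    using cong_trans cong_add_lcancel_nat by blast
  then show ?case using Suc by blast
qed

text \<open>Pigeonhole: only finitely many pairs of consecutive residues exist, and a repeated pair
  yields a period by running backwards.\<close>

lemma ex_fib_period:
  assumes "m > 0"
  shows "\<exists>r>0. fib_period m r"
proof -
  define f where "f = (\<lambda>i. (fib i mod m, fib (Suc i) mod m))"
  have "range f \<subseteq> {..<m} \<times> {..<m}"
    using assms by (auto simp: f_def)
  then have "finite (range f)"
    by (rule finite_subset) simp
  then have "\<not> inj f"
    using range_inj_infinite by blast
  then obtain i j where "f i = f j" "i < j"
    unfolding inj_def by (metis linorder_neqE_nat)
  then have "fib_period m (j - i)"
    by (intro fib_period_of_shift[of i]) (auto simp: f_def cong_def)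
  with \<open>i < j\<close> show ?thesis
    using zero_less_diff by blast
qed

lemma pisano_fib_eq: "pisano_fib m = (LEAST r. r > 0 \<and> fib_period m r)"
  by (simp add: pisano_fib_def fib_period_def)

lemma fib_period_pisano_fib:
  assumes "m > 0"
  shows "fib_period m (pisano_fib m)"
  using LeastI_ex[OF ex_fib_period[OF assms]] unfolding pisano_fib_eq by blast

section \<open>Sums of \<open>k\<close> consecutive terms and their gcd\<close>

lemma sum_fib: "(\<Sum>i<k. fib (n + i)) + fib (Suc n) = fib (Suc n + k)"
  by (induction k) (auto simp: algebra_simps)

lemma dvd_sum_fib_iff:
  "m dvd (\<Sum>i<k. fib (n + i)) \<longleftrightarrow> [fib (Suc n + k) = fib (Suc n)] (mod m)"
  unfolding sum_fib[symmetric] cong_add_rcancel_0_nat by (simp add: cong_0_iff)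

lemma dvd_fib_sum_gcd_iff: "m dvd fib_sum_gcd k \<longleftrightarrow> fib_period m k"
proof
  assume "m dvd fib_sum_gcd k"
  then have *: "[fib (Suc n + k) = fib (Suc n)] (mod m)" if "n \<ge> 1" for n
    using that unfolding fib_sum_gcd_def dvd_Gcd_iff dvd_sum_fib_iff[symmetric] by blast
  show "fib_period m k"
    \<comment> \<open>The sums starting at 1 and 2 give agreement at the indices 2 and 3, which is
      enough.\<close>
    by (rule fib_period_of_shift[of "Suc 1"]; rule *) simp_all
next
  assume "fib_period m k"
  then show "m dvd fib_sum_gcd k"
    unfolding fib_sum_gcd_def using fib_period_shift[of m k]
    by (auto simp: dvd_Gcd_iff dvd_sum_fib_iff simp del: add_Suc)
qed

text \<open>Both sides have the same divisors.\<close>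

lemma fib_sum_gcd_eq: "fib_sum_gcd k = gcd (fib k) (fib (k + 1) - 1)"
proof -
  have "fib (k + 1) \<ge> 1"
    using fib_neq_0_nat[of "k + 1"] by simp
  then have "fib_period m k \<longleftrightarrow> m dvd gcd (fib k) (fib (k + 1) - 1)" for m
    unfolding fib_period_def using cong_altdef_nat[of 1 "fib (k + 1)" m]
    by (auto simp: cong_0_iff)
  then show ?thesis
    using dvd_fib_sum_gcd_iff[of _ k] by (metis dvd_antisym dvd_refl)
qed

section \<open>Lucas numbers and the value of the gcd\<close>

lemma lucas_Suc: "lucas (Suc n) = fib n + fib (Suc (Suc n))"
  by (induction n rule: fib.induct) auto

lemma fib_double: "fib (2 * n) = fib n * lucas n"
proof (cases n)
  case (Suc j)
  have "fib (2 * n) = fib (Suc (n + j))"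
    by (simp only: Suc mult_2 add_Suc_right)
  also have "\<dots> = fib (Suc j) * fib (Suc n) + fib j * fib n"
    by (rule fib_add)
  finally show ?thesis
    unfolding Suc lucas_Suc by (simp only: algebra_simps)
qed simp

lemma fib_double_Suc: "fib (Suc (2 * n)) = (fib (Suc n))\<^sup>2 + (fib n)\<^sup>2"
  using fib_add[of n n] by (simp add: mult_2 power2_eq_square)

lemma fib_double_Suc_minus_1_even:
  assumes "even h"
  shows "fib (2 * h + 1) - 1 = fib h * lucas (Suc h)"
proof -
  \<comment> \<open>Cassini at \<open>h\<close> replaces the square of \<open>fib (Suc h)\<close>,
    leaving \<open>fib h\<close> as a common factor.\<close>
  have "fib (Suc (Suc h)) * fib h = (fib (Suc h))\<^sup>2 - 1"
    using fib_Cassini_nat assms by simp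
  moreover have "(fib (Suc h))\<^sup>2 \<ge> 1"
    using fib_neq_0_nat[of "Suc h"] by (simp add: Suc_le_eq)
  ultimately have "fib (2 * h + 1) - 1 = fib (Suc (Suc h)) * fib h + (fib h)\<^sup>2"
    using fib_double_Suc[of h] by simp
  then show ?thesis
    by (simp add: lucas_Suc power2_eq_square algebra_simps)
qed

lemma fib_double_Suc_minus_1_odd:
  assumes "odd h"
  shows "fib (2 * h + 1) - 1 = lucas h * fib (Suc h)"
proof -
  obtain n where h: "h = Suc n" and n: "even n"
    using assms by (cases h) auto
  \<comment> \<open>For odd \<open>h\<close>, Cassini at \<open>h - 1\<close> replaces the other
    square, so the common factor is \<open>fib (Suc h)\<close>.\<close>
  have "fib (Suc h) * fib n = (fib h)\<^sup>2 - 1"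
    using fib_Cassini_nat[of n] n h by simp
  moreover have "(fib h)\<^sup>2 \<ge> 1"
    using fib_neq_0_nat[of h] h by (simp add: Suc_le_eq)
  ultimately have "fib (2 * h + 1) - 1 = (fib (Suc h))\<^sup>2 + fib (Suc h) * fib n"
    using fib_double_Suc[of h] by simp
  then show ?thesis
    by (simp add: h lucas_Suc power2_eq_square algebra_simps)
qed

lemma coprime_lucas_Suc: "coprime (lucas n) (lucas (Suc n))"
proof (induction n)
  case (Suc n)
  then show ?case
    unfolding lucas.simps(3) coprime_iff_gcd_eq_1 gcd_add2 by (simp only: gcd.commute)
qed simp

text \<open>After extracting \<open>fib h\<close>, the cofactors are consecutive Lucas numbers,
  hence coprime.\<close>

lemma fib_sum_gcd_even:
  assumes "even h"
  shows "fib_sum_gcd (2 * h) = fib h"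
  using coprime_lucas_Suc[of h]
  unfolding fib_sum_gcd_eq fib_double fib_double_Suc_minus_1_even[OF assms] gcd_mult_left
  by simp

lemma fib_sum_gcd_odd:
  assumes "odd h"
  shows "fib_sum_gcd (2 * h) = lucas h"
proof -
  have "fib_sum_gcd (2 * h) = gcd (lucas h * fib h) (lucas h * fib (Suc h))"
    unfolding fib_sum_gcd_eq fib_double fib_double_Suc_minus_1_odd[OF assms]
    by (simp add: mult.commute)
  then show ?thesis
    using coprime_fib_Suc_nat[of h] by (simp add: gcd_mult_left del: fib.simps)
qed

section \<open>Growth, and minimality of the period\<close>

lemma fib_less_Suc:
  assumes "n \<ge> 2"
  shows "fib n < fib (Suc n)"
proof -
  obtain j where "n = Suc j" "j > 0"
    using assms by (cases n) auto
  then show ?thesis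
    using fib_neq_0_nat[of j] by simp
qed

lemma fib_less_mono:
  assumes "2 \<le> m" and "m < n"
  shows "fib m < fib n"
  using fib_less_Suc[OF assms(1)] fib_mono[of "Suc m" n] assms(2) by linarith

lemma fib_less_lucas:
  assumes "n \<ge> 2"
  shows "fib n < lucas n"
proof -
  obtain j where "n = Suc j" "j > 0"
    using assms by (cases n) auto
  then show ?thesis
    using fib_neq_0_nat[of j] by (simp add: lucas_Suc)
qed

lemma no_smaller_fib_period:
  assumes h: "h \<ge> 3" and r: "0 < r" "r < 2 * h"
  shows "\<not> fib_period (fib_sum_gcd (2 * h)) r"
proof
  let ?m = "fib_sum_gcd (2 * h)"
  assume per: "fib_period ?m r"
  define g where "g = gcd r (2 * h)"
  \<comment> \<open>\<open>?m\<close> divides both \<open>fib r\<close> and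
    \<open>fib (2 * h)\<close>, hence \<open>fib\<close> of the gcd of the indices.\<close>
  have "?m dvd fib g"
    using per unfolding g_def fib_gcd fib_period_def fib_sum_gcd_eq[of "2 * h"]
    by (simp add: cong_0_iff)
  moreover have "g > 0"
    using r by (simp add: g_def)
  ultimately have le: "?m \<le> fib g"
    using fib_neq_0_nat dvd_imp_le by blast
  have "g \<le> r"
    using r by (simp add: g_def)
  obtain c where c: "2 * h = g * c"
    using gcd_dvd2[of r "2 * h"] unfolding g_def by (elim dvdE)
  \<comment> \<open>\<open>c = 1\<close> would give \<open>g = 2 * h > r\<close>.\<close>
  have "c \<ge> 2"
    using c \<open>g \<le> r\<close> r h by (cases c rule: fib.cases) auto
  then have "g * 2 \<le> 2 * h"
    unfolding c by simp
  then have "g \<le> h" by simp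
  show False
  proof (cases "even h")
    case False
    then have "lucas h \<le> fib h"
      using le fib_mono[OF \<open>g \<le> h\<close>] by (simp add: fib_sum_gcd_odd)
    then show False
      using fib_less_lucas[of h] h by simp
  next
    case True
    then have m: "?m = fib h"
      by (rule fib_sum_gcd_even)
    have "g = h"
    proof (rule ccontr)
      assume "g \<noteq> h"
      then have "fib g \<le> fib (h - 1)"
        using \<open>g \<le> h\<close> by (intro fib_mono) simp
      also have "\<dots> < fib h"
        using h by (intro fib_less_mono) auto
      finally show False
        using le m by simp
    qed
    then have "h dvd r"
      by (metis g_def gcd_dvd1)
    then obtain d where d: "r = h * d" ..
    with r h have "d = 1"
      by (cases d rule: fib.cases) auto
    with d have "r = h" by simp
    \<comment> \<open>Parity excludes \<open>h = 3\<close>, where \<open>fib (h - 1) = 1\<close>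
      would give no contradiction.\<close>
    have "h \<ge> 4"
      using h True by (cases "h = 3") auto
    define j where "j = h - 1"
    have j: "h = Suc j" "j \<ge> 3"
      using \<open>h \<ge> 4\<close> by (auto simp: j_def)
    have "[fib h + fib j = 1] (mod fib h)"
      using per \<open>r = h\<close> m j unfolding fib_period_def by simp
    then have "[fib j = 1] (mod fib h)"
      by (simp add: cong_def)
    moreover have "1 < fib j"
      using fib_less_mono[of 2 j] j by simp
    moreover have "fib j < fib h"
      using j by (intro fib_less_mono) auto
    ultimately show False
      using cong_less_modulus_unique_nat[of "fib j" 1 "fib h"] by simp
  qed
qed

theorem theorem6p9:
  fixes k m\<^sub>F :: nat
  assumes "k \<ge> 6" and "even k" and "m\<^sub>F = fib_sum_gcd k"
  shows "pisano_fib m\<^sub>F = k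
    \<and> (\<forall>m > m\<^sub>F. pisano_fib m \<noteq> k)
    \<and> ([k = 0] (mod 4) \<longrightarrow> m\<^sub>F = fib (k div 2))
    \<and> ([k = 2] (mod 4) \<longrightarrow> m\<^sub>F = lucas (k div 2))"
proof (intro conjI allI impI)
  obtain h where k: "k = 2 * h"
    using \<open>even k\<close> ..
  with assms have h: "h \<ge> 3" by simp
  show "pisano_fib m\<^sub>F = k"
    unfolding pisano_fib_eq
  proof (rule Least_equality)
    show "0 < k \<and> fib_period m\<^sub>F k"
      using assms dvd_fib_sum_gcd_iff[of m\<^sub>F k] by simp
  next
    fix r
    assume "0 < r \<and> fib_period m\<^sub>F r"
    then show "k \<le> r"
      using no_smaller_fib_period[OF h] assms(3) k not_le by blast
  qed
  show "pisano_fib m \<noteq> k" if "m > m\<^sub>F" for m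
  proof
    assume "pisano_fib m = k"
    \<comment> \<open>Here \<open>m > 0\<close>, so the least period is attained and
      \<open>k\<close> really is a period modulo \<open>m\<close>.\<close>
    then have "m dvd m\<^sub>F"
      using fib_period_pisano_fib[of m] that assms(3) dvd_fib_sum_gcd_iff by auto
    moreover have "m\<^sub>F > 0"
      using fib_neq_0_nat[of k] assms(1) unfolding assms(3) fib_sum_gcd_eq by simp
    ultimately show False
      using that dvd_imp_le by fastforce
  qed
  show "m\<^sub>F = fib (k div 2)" if "[k = 0] (mod 4)"
  proof -
    have "even h"
      using that k by (auto simp: cong_0_iff)
    then show ?thesis
      using assms(3) k fib_sum_gcd_even by simp
  qed
  show "m\<^sub>F = lucas (k div 2)" if "[k = 2] (mod 4)"
  proof -
    have "odd h"
      using that k unfolding cong_def by presburger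
    then show ?thesis
      using assms(3) k fib_sum_gcd_odd by simp
  qed
qed

end
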